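(* Let $(G,+)$ be a finite abelian group and let $S\subseteq G$ be a nonempty subset. Then $$N_{G,S}\ge \frac{|H_G(S)|-1}{|H_G(S)|}|G|+\left\lceil\left(\frac{|G|}{|H_G(S)|}\right)^{1-|H_G(S)|/|S|}\right\rceil.$$
   Context: For a finite abelian group $(G,+)$, an element $g\in G$ and a subset $S\subseteq G$, let $g+S=\{g+s: s\in S\}$. The stabilizer of $S$ is the subgroup $H_G(S)=\{g'\in G: g'+S=S\}$ of $G$. $N_{G,S}$ denotes the smallest integer $N\ge |S|$ such that for every subset $A\subseteq G$ with exactly $N$ elements there exists $g\in G$ with $g+S\subseteq A$. *)

theory Defs
  imports Complex_Main "HOL-Algebra.Group_Action"
begin

text \<open>The group is written multiplicatively, as in HOL-Algebra: the translate $g + S$ is the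
  left coset \<^term>\<open>g <#\<^bsub>G\<^esub> S\<close>.\<close>

definition set_stabilizer :: "('a, 'b) monoid_scheme \<Rightarrow> 'a set \<Rightarrow> 'a set"
  where "set_stabilizer G S = stabilizer G (\<lambda>g T. g <#\<^bsub>G\<^esub> T) S"

definition forces_translate :: "('a, 'b) monoid_scheme \<Rightarrow> 'a set \<Rightarrow> nat \<Rightarrow> bool"
  where "forces_translate G S N \<longleftrightarrow>
    (\<forall>A. A \<subseteq> carrier G \<and> card A = N \<longrightarrow> (\<exists>g\<in>carrier G. g <#\<^bsub>G\<^esub> S \<subseteq> A))"

definition translate_number :: "('a, 'b) monoid_scheme \<Rightarrow> 'a set \<Rightarrow> nat"
  where "translate_number G S = (LEAST N. card S \<le> N \<and> forces_translate G S N)"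

text \<open>The minimum is attained, since \<^term>\<open>N = order G\<close> is always admissible.\<close>

lemma translate_number_admissible:
  assumes "comm_group G" "finite (carrier G)" "S \<subseteq> carrier G"
  shows "card S \<le> translate_number G S \<and> forces_translate G S (translate_number G S)"
proof -
  interpret comm_group G by fact
  have "card S \<le> order G"
    using assms by (simp add: order_def card_mono)
  moreover have "forces_translate G S (order G)"
    unfolding forces_translate_def
  proof (intro allI impI)
    fix A assume "A \<subseteq> carrier G \<and> card A = order G"
    then have "A = carrier G"
      using assms(2) by (simp add: card_subset_eq order_def)
    then show "\<exists>g\<in>carrier G. g <#\<^bsub>G\<^esub> S \<subseteq> A"
      using assms(3) l_coset_subset_G by blast
  qed
  ultimately show ?thesis
    unfolding translate_number_def by (intro LeastI conjI)
qed

end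

theory Submission
  imports Defs
begin

text \<open>Let \<open>H\<close> be the stabilizer of \<open>S\<close>, let \<open>h = |H|\<close>, and choose a transversal \<open>T\<close> of the cosets
  of \<open>H\<close>, so that \<open>n = |T| = |G|/h\<close>. Every translate of \<open>S\<close> is a union of \<open>k = |S|/h\<close> cosets, hence
  meets \<open>T\<close> in exactly \<open>k\<close> points, and translating by two elements of the same coset gives the same
  set; so there are at most \<open>n\<close> traces \<open>T \<inter> g S\<close> (lemma \<open>card_transversal_traces_le\<close>).

  The points of a coset of \<open>H\<close> lie in the same translates, so a set that avoids all translates may
  be enlarged by everything outside \<open>T\<close> once its missing points are moved into \<open>T\<close>: whether
  \<open>A = (G - T) \<union> B\<close> with \<open>B \<subseteq> T\<close> contains a translate of \<open>S\<close> depends only on whether \<open>B\<close> contains a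
  trace. Such an \<open>A\<close> has \<open>(h - 1) n + |B|\<close> elements, which is where the first summand of the bound
  comes from. If \<open>N = (h - 1) n + M\<close> forces a translate, then every \<open>M\<close>-subset of \<open>T\<close> contains one of
  at most \<open>n\<close> sets of size \<open>k\<close>. Counting the \<open>M\<close>-subsets that contain a given trace
  (lemma \<open>unavoidable_family_bound\<close>) yields \<open>(n choose M) \<le> n ((n - k) choose (M - k))\<close>, hence
  \<open>n ^ k \<le> n M ^ k\<close>, which is \<open>M \<ge> n powr (1 - 1/k)\<close>. Since \<open>M\<close> is an integer, the ceiling is free.\<close>

section \<open>Families of sets contained in every large set\<close>

lemma card_supersets_of_card:
  assumes "finite T" "F \<subseteq> T" "card F \<le> M"
  shows "card {A. F \<subseteq> A \<and> A \<subseteq> T \<and> card A = M} = (card T - card F) choose (M - card F)"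
proof -
  have fin: "finite F" "finite (T - F)"
    using assms finite_subset by auto
  have "bij_betw (\<lambda>B. F \<union> B) {B. B \<subseteq> T - F \<and> card B = M - card F}
          {A. F \<subseteq> A \<and> A \<subseteq> T \<and> card A = M}"
  proof (rule bij_betwI[where g = "\<lambda>A. A - F"])
    show "(\<lambda>B. F \<union> B) \<in> {B. B \<subseteq> T - F \<and> card B = M - card F}
            \<rightarrow> {A. F \<subseteq> A \<and> A \<subseteq> T \<and> card A = M}"
    proof
      fix B assume B: "B \<in> {B. B \<subseteq> T - F \<and> card B = M - card F}"
      then have "finite B" "F \<inter> B = {}"
        using fin finite_subset by auto
      then have "card (F \<union> B) = M"
        using B fin assms(3) by (simp add: card_Un_disjoint)
      then show "F \<union> B \<in> {A. F \<subseteq> A \<and> A \<subseteq> T \<and> card A = M}"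
        using B assms(2) by auto
    qed
    show "(\<lambda>A. A - F) \<in> {A. F \<subseteq> A \<and> A \<subseteq> T \<and> card A = M}
            \<rightarrow> {B. B \<subseteq> T - F \<and> card B = M - card F}"
      using fin by (auto simp: card_Diff_subset)
  qed auto
  then have "card {A. F \<subseteq> A \<and> A \<subseteq> T \<and> card A = M} = card {B. B \<subseteq> T - F \<and> card B = M - card F}"
    by (simp add: bij_betw_same_card)
  also have "\<dots> = card (T - F) choose (M - card F)"
    by (rule n_subsets[OF fin(2)])
  finally show ?thesis
    using fin assms(2) by (simp add: card_Diff_subset)
qed

text \<open>The proportion of \<open>M\<close>-subsets of an \<open>n\<close>-set that contain a given \<open>k\<close>-set is
  \<open>\<Prod>i<k. (M - i)/(n - i)\<close>, and every factor is at most \<open>M/n\<close>.\<close>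

lemma choose_diff_diff_le:
  fixes n M k :: nat
  assumes "k \<le> M" "M \<le> n"
  shows "((n - k) choose (M - k)) * n ^ k \<le> (n choose M) * M ^ k"
  using assms(1)
proof (induction k)
  case (Suc k)
  let ?c = "\<lambda>k. (n - k) choose (M - k)"
  have pos: "0 < n - k"
    using Suc.prems assms(2) by simp
  have absorb: "?c (Suc k) * (n - k) = ?c k * (M - k)"
    using binomial_absorption[of "M - Suc k" "n - k"] Suc.prems
    by (simp add: Suc_diff_Suc mult.commute)
  have "M * k \<le> n * k"
    using assms(2) by simp
  then have "M * n - k * n \<le> M * n - M * k"
    by (simp only: mult.commute[of k n] diff_le_mono2)
  then have ratio: "(M - k) * n \<le> M * (n - k)"
    by (simp only: diff_mult_distrib diff_mult_distrib2)
  have "(?c (Suc k) * n ^ Suc k) * (n - k) = (?c (Suc k) * (n - k)) * n * n ^ k"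
    by (simp add: mult_ac)
  also have "\<dots> = (?c k * n ^ k) * ((M - k) * n)"
    unfolding absorb by (simp add: mult_ac)
  also have "\<dots> \<le> ((n choose M) * M ^ k) * (M * (n - k))"
    using Suc.IH Suc.prems by (intro mult_le_mono[OF _ ratio]) simp
  also have "\<dots> = ((n choose M) * M ^ Suc k) * (n - k)"
    by (simp add: mult_ac)
  finally show ?case
    using pos by simp
qed simp

text \<open>A double count of the pairs \<open>F \<subseteq> A\<close>, or equivalently a union bound for a random
  \<open>M\<close>-subset: each \<open>F\<close> lies in it with probability at most \<open>(M/n)^k\<close>, so \<open>|\<F>|\<close> sets can only
  catch all \<open>M\<close>-subsets if \<open>|\<F>| (M/n)^k \<ge> 1\<close>.\<close>

lemma unavoidable_family_bound:
  assumes fin: "finite T" and M: "M \<le> card T"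
    and fam: "finite \<F>" "\<And>F. F \<in> \<F> \<Longrightarrow> F \<subseteq> T \<and> card F = k"
    and unavoidable: "\<And>A. A \<subseteq> T \<Longrightarrow> card A = M \<Longrightarrow> \<exists>F\<in>\<F>. F \<subseteq> A"
  shows "card T ^ k \<le> card \<F> * M ^ k"
proof -
  let ?n = "card T"
  have kM: "k \<le> M"
  proof -
    obtain A where A: "A \<subseteq> T" "card A = M" "finite A"
      using obtain_subset_with_card_n[OF M] by blast
    then obtain F where "F \<in> \<F>" "F \<subseteq> A"
      using unavoidable by blast
    then show ?thesis
      using fam(2) A card_mono by metis
  qed
  have "?n choose M = card {A. A \<subseteq> T \<and> card A = M}"
    using n_subsets[OF fin] by simp
  also have "\<dots> \<le> card (\<Union>F\<in>\<F>. {A. F \<subseteq> A \<and> A \<subseteq> T \<and> card A = M})"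
  proof (rule card_mono)
    show "finite (\<Union>F\<in>\<F>. {A. F \<subseteq> A \<and> A \<subseteq> T \<and> card A = M})"
      using fin by (auto intro!: finite_subset[OF _ finite_Pow_iff[THEN iffD2, OF fin]])
    show "{A. A \<subseteq> T \<and> card A = M} \<subseteq> (\<Union>F\<in>\<F>. {A. F \<subseteq> A \<and> A \<subseteq> T \<and> card A = M})"
      using unavoidable by auto
  qed
  also have "\<dots> \<le> (\<Sum>F\<in>\<F>. card {A. F \<subseteq> A \<and> A \<subseteq> T \<and> card A = M})"
    by (rule card_UN_le[OF fam(1)])
  also have "\<dots> = (\<Sum>F\<in>\<F>. (?n - k) choose (M - k))"
    using fam(2) kM fin by (intro sum.cong) (auto simp: card_supersets_of_card)
  finally have "?n choose M \<le> card \<F> * ((?n - k) choose (M - k))"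
    by simp
  then have "(?n choose M) * ?n ^ k \<le> card \<F> * (((?n - k) choose (M - k)) * ?n ^ k)"
    by (metis mult.assoc mult_le_mono1)
  also have "\<dots> \<le> card \<F> * ((?n choose M) * M ^ k)"
    using choose_diff_diff_le[OF kM M] by (rule mult_le_mono2)
  finally have "(?n choose M) * ?n ^ k \<le> (?n choose M) * (card \<F> * M ^ k)"
    by (simp add: mult_ac)
  moreover have "0 < ?n choose M"
    using M by simp
  ultimately show ?thesis
    by simp
qed

section \<open>Transversals of cosets\<close>

context group
begin

definition right_transversal :: "'a set \<Rightarrow> 'a set \<Rightarrow> bool"
  where "right_transversal H T \<longleftrightarrow>
    T \<subseteq> carrier G \<and> (\<forall>x\<in>carrier G. \<exists>!t. t \<in> T \<and> t \<in> H #> x)"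

lemma right_transversal_exists:
  assumes H: "subgroup H G"
  shows "\<exists>T. right_transversal H T"
proof -
  have coset: "\<exists>y. y \<in> H #> x" if "x \<in> carrier G" for x
    using rcos_self[OF that H] by blast
  define rep where "rep C = (SOME y. y \<in> C)" for C :: "'a set"
  have rep: "rep (H #> x) \<in> H #> x" if "x \<in> carrier G" for x
    unfolding rep_def using coset[OF that] by (rule someI_ex)
  define T where "T = (\<lambda>x. rep (H #> x)) ` carrier G"
  have H_sub: "H \<subseteq> carrier G"
    using H by (rule subgroup.subset)
  have "T \<subseteq> carrier G"
    unfolding T_def using rep r_coset_subset_G[OF H_sub] by blast
  moreover have "\<exists>!t. t \<in> T \<and> t \<in> H #> x" if x: "x \<in> carrier G" for x
  proof (rule ex1I[of _ "rep (H #> x)"])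
    show "rep (H #> x) \<in> T \<and> rep (H #> x) \<in> H #> x"
      using x rep by (auto simp: T_def)
    fix t assume t: "t \<in> T \<and> t \<in> H #> x"
    then obtain y where y: "y \<in> carrier G" "t = rep (H #> y)"
      by (auto simp: T_def)
    then have "t \<in> H #> y"
      using rep by simp
    then have "H #> y = H #> x"
      using t x y H repr_independence by metis
    then show "t = rep (H #> x)"
      using y by simp
  qed
  ultimately have "right_transversal H T"
    by (simp only: right_transversal_def) simp
  then show ?thesis
    by (rule exI)
qed

text \<open>A union \<open>U\<close> of cosets is \<open>H \<times> (T \<inter> U)\<close>: its elements are uniquely of the form \<open>a \<otimes> t\<close>, and
  \<open>t\<close> stays in \<open>U\<close>.\<close>

lemma card_transversal_Int:
  assumes H: "subgroup H G" and T: "right_transversal H T"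
    and U: "U \<subseteq> carrier G" "\<And>a u. a \<in> H \<Longrightarrow> u \<in> U \<Longrightarrow> a \<otimes> u \<in> U"
  shows "card U = card H * card (T \<inter> U)"
proof -
  have H_sub: "H \<subseteq> carrier G"
    using H by (rule subgroup.subset)
  have "bij_betw (\<lambda>(a, t). a \<otimes> t) (H \<times> (T \<inter> U)) U"
  proof (rule bij_betw_imageI)
    show "inj_on (\<lambda>(a, t). a \<otimes> t) (H \<times> (T \<inter> U))"
    proof (rule inj_onI, clarify)
      fix a s b t
      assume as: "a \<in> H" "b \<in> H" "s \<in> T" "s \<in> U" "t \<in> T" "t \<in> U" and eq: "a \<otimes> s = b \<otimes> t"
      have carr: "a \<in> carrier G" "b \<in> carrier G" "s \<in> carrier G" "t \<in> carrier G"
        using as U(1) H_sub by auto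
      have "H #> s = H #> (a \<otimes> s)"
        using as carr H by (metis coset_join2 coset_mult_assoc H_sub)
      moreover have "H #> t = H #> (b \<otimes> t)"
        using as carr H by (metis coset_join2 coset_mult_assoc H_sub)
      ultimately have "H #> s = H #> t"
        using eq by simp
      then have "s \<in> H #> t" "t \<in> H #> t"
        using rcos_self[OF carr(3) H] rcos_self[OF carr(4) H] by auto
      then have st: "s = t"
        using T as carr unfolding right_transversal_def by blast
      then show "a = b \<and> s = t"
        using eq carr by simp
    qed
    show "(\<lambda>(a, t). a \<otimes> t) ` (H \<times> (T \<inter> U)) = U"
    proof
      show "(\<lambda>(a, t). a \<otimes> t) ` (H \<times> (T \<inter> U)) \<subseteq> U"
        using U(2) by auto
      show "U \<subseteq> (\<lambda>(a, t). a \<otimes> t) ` (H \<times> (T \<inter> U))"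
      proof
        fix u assume u: "u \<in> U"
        then have u_carr: "u \<in> carrier G"
          using U(1) by auto
        then obtain t where t: "t \<in> T" "t \<in> H #> u"
          using T unfolding right_transversal_def by blast
        then obtain a where a: "a \<in> H" "t = a \<otimes> u"
          by (auto simp: r_coset_def)
        then have "u = inv a \<otimes> t" "inv a \<in> H" "t \<in> U"
          using u u_carr U(2) H H_sub by (auto simp: m_assoc[symmetric] subgroup.m_inv_closed)
        then show "u \<in> (\<lambda>(a, t). a \<otimes> t) ` (H \<times> (T \<inter> U))"
          using t by force
      qed
    qed
  qed
  then have "card (H \<times> (T \<inter> U)) = card U"
    by (rule bij_betw_same_card)
  then show ?thesis
    by (simp add: card_cartesian_product)
qed

section \<open>The stabilizer and the traces of translates\<close>

lemma mem_set_stabilizer: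
  "a \<in> set_stabilizer G S \<longleftrightarrow> a \<in> carrier G \<and> a <# S = S"
  by (auto simp: set_stabilizer_def stabilizer_def)

lemma subgroup_set_stabilizer:
  assumes S: "S \<subseteq> carrier G"
  shows "subgroup (set_stabilizer G S) G"
proof (rule subgroupI)
  have "\<one> \<in> set_stabilizer G S"
    using S by (simp add: mem_set_stabilizer lcos_mult_one)
  then show "set_stabilizer G S \<noteq> {}"
    by blast
  fix a assume a: "a \<in> set_stabilizer G S"
  then have "inv a <# S = inv a <# (a <# S)"
    by (simp add: mem_set_stabilizer)
  also have "\<dots> = (inv a \<otimes> a) <# S"
    using a S by (intro lcos_m_assoc) (simp_all add: mem_set_stabilizer)
  also have "\<dots> = S"
    using a S by (simp add: mem_set_stabilizer lcos_mult_one)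
  finally show "inv a \<in> set_stabilizer G S"
    using a by (simp add: mem_set_stabilizer)
next
  fix a b assume "a \<in> set_stabilizer G S" "b \<in> set_stabilizer G S"
  then show "a \<otimes> b \<in> set_stabilizer G S"
    using S by (auto simp: mem_set_stabilizer lcos_m_assoc[symmetric])
qed (auto simp: mem_set_stabilizer)

lemma card_l_coset:
  assumes "g \<in> carrier G" "S \<subseteq> carrier G"
  shows "card (g <# S) = card S"
proof -
  have "g <# S = (\<lambda>s. g \<otimes> s) ` S"
    by (auto simp: l_coset_def)
  moreover have "inj_on (\<lambda>s. g \<otimes> s) S"
    using assms by (meson inj_on_cmult inj_on_subset)
  ultimately show ?thesis
    by (simp add: card_image)
qed

end

context comm_group
begin

lemma l_coset_stabilizer_mult:
  assumes "S \<subseteq> carrier G" "g \<in> carrier G" "a \<in> set_stabilizer G S"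
  shows "(a \<otimes> g) <# S = g <# S"
proof -
  have "(a \<otimes> g) <# S = (g \<otimes> a) <# S"
    using assms by (simp add: mem_set_stabilizer m_comm)
  also have "\<dots> = g <# (a <# S)"
    using assms by (intro lcos_m_assoc[symmetric]) (simp_all add: mem_set_stabilizer)
  also have "\<dots> = g <# S"
    using assms(3) by (simp add: mem_set_stabilizer)
  finally show ?thesis .
qed

lemma card_transversal_trace:
  assumes S: "S \<subseteq> carrier G" and T: "right_transversal (set_stabilizer G S) T"
    and g: "g \<in> carrier G"
  shows "card S = card (set_stabilizer G S) * card (T \<inter> (g <# S))"
proof -
  have "a \<otimes> u \<in> g <# S" if a: "a \<in> set_stabilizer G S" and u: "u \<in> g <# S" for a u
  proof -
    have "a \<otimes> u \<in> a <# (g <# S)"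
      using u by (auto simp: l_coset_def)
    also have "\<dots> = g <# S"
      using a g S by (simp add: lcos_m_assoc l_coset_stabilizer_mult mem_set_stabilizer[of a])
    finally show ?thesis .
  qed
  then have "card (g <# S) = card (set_stabilizer G S) * card (T \<inter> (g <# S))"
    using S g by (intro card_transversal_Int subgroup_set_stabilizer T l_coset_subset_G)
  then show ?thesis
    using card_l_coset[OF g S] by simp
qed

text \<open>A translate depends only on the coset of the translating element, so the elements of \<open>T\<close>
  already produce all of them.\<close>

lemma card_transversal_traces_le:
  assumes S: "S \<subseteq> carrier G" and T: "right_transversal (set_stabilizer G S) T"
    and fin: "finite T"
  shows "card ((\<lambda>g. T \<inter> (g <# S)) ` carrier G) \<le> card T"
proof -
  have "(\<lambda>g. T \<inter> (g <# S)) ` carrier G \<subseteq> (\<lambda>g. T \<inter> (g <# S)) ` T"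
  proof clarify
    fix g assume g: "g \<in> carrier G"
    then obtain t where t: "t \<in> T" "t \<in> set_stabilizer G S #> g"
      using T unfolding right_transversal_def by blast
    then obtain a where "a \<in> set_stabilizer G S" "t = a \<otimes> g"
      by (auto simp: r_coset_def)
    then have "t <# S = g <# S"
      using S g by (simp add: l_coset_stabilizer_mult)
    then show "T \<inter> (g <# S) \<in> (\<lambda>g. T \<inter> (g <# S)) ` T"
      using t(1) by (metis imageI)
  qed
  then show ?thesis
    using fin by (rule surj_card_le[rotated])
qed

end

section \<open>The lower bound\<close>

lemma powr_le_of_power_le:
  fixes n M k :: nat
  assumes "0 < k" "0 < n" "n ^ k \<le> n * M ^ k"
  shows "real n powr (1 - 1 / real k) \<le> real M"
proof -
  have "real (n ^ k) \<le> real (n * M ^ k)"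
    using assms(3) by (simp only: of_nat_le_iff)
  then have le: "real n ^ k / real n \<le> real M ^ k"
    using assms(2) by (simp add: divide_le_eq mult.commute)
  have "(real n powr (1 - 1 / real k)) ^ k = real n powr ((1 - 1 / real k) * real k)"
    using assms(2) by (simp add: powr_power mult.commute)
  also have "(1 - 1 / real k) * real k = real k - 1"
    using assms(1) by (simp add: left_diff_distrib)
  also have "real n powr (real k - 1) = real n ^ k / real n"
    using assms(2) by (simp add: powr_diff powr_realpow)
  finally have "(real n powr (1 - 1 / real k)) ^ k \<le> real M ^ k"
    using le by simp
  then show ?thesis
    using assms(1) by (simp add: power_mono_iff)
qed

text \<open>The test sets are \<open>(G - T) \<union> B\<close> with \<open>B \<subseteq> T\<close>. Fewer than \<open>|G - T|\<close> elements never force a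
  translate, because they fit into \<open>G - T\<close>, which contains none.\<close>

lemma (in comm_group) forces_translate_transversal_bound:
  assumes fin: "finite (carrier G)" and S: "S \<subseteq> carrier G" "S \<noteq> {}"
    and T: "right_transversal (set_stabilizer G S) T"
    and k: "card S = card (set_stabilizer G S) * k"
    and forces: "forces_translate G S N"
  shows "\<exists>M. N = card (carrier G - T) + M \<and> card T ^ k \<le> card T * M ^ k"
proof -
  let ?H = "set_stabilizer G S"
  let ?R = "carrier G - T"
  have T_sub: "T \<subseteq> carrier G"
    using T by (simp add: right_transversal_def)
  have finT: "finite T" and finR: "finite ?R"
    using T_sub fin finite_subset by auto
  have "0 < card S"
    using S fin finite_subset by (auto simp: card_gt_0_iff)
  then have pos: "0 < card ?H" "0 < k"
    using k by auto
  have trace: "card (T \<inter> (g <# S)) = k" if "g \<in> carrier G" for g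
    using card_transversal_trace[OF S(1) T that] k pos by simp
  have "card ?R \<le> N"
  proof (rule ccontr)
    assume "\<not> card ?R \<le> N"
    then obtain A where A: "A \<subseteq> ?R" "card A = N"
      using obtain_subset_with_card_n[of N ?R] by auto
    then obtain g where g: "g \<in> carrier G" "g <# S \<subseteq> A"
      using forces unfolding forces_translate_def by blast
    then have "T \<inter> (g <# S) = {}"
      using A by auto
    then show False
      using trace[OF g(1)] pos by simp
  qed
  then obtain M where M: "N = card ?R + M"
    using le_Suc_ex by blast
  have "card T ^ k \<le> card T * M ^ k"
  proof (cases "M \<le> card T")
    case True
    let ?F = "(\<lambda>g. T \<inter> (g <# S)) ` carrier G"
    have "card T ^ k \<le> card ?F * M ^ k"
    proof (rule unavoidable_family_bound[OF finT True])
      fix B assume B: "B \<subseteq> T" "card B = M"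
      then have "?R \<union> B \<subseteq> carrier G" "card (?R \<union> B) = N"
        using T_sub finT finR finite_subset[OF B(1)] M by (auto intro!: card_Un_disjoint)
      then obtain g where g: "g \<in> carrier G" "g <# S \<subseteq> ?R \<union> B"
        using forces unfolding forces_translate_def by blast
      then have "T \<inter> (g <# S) \<subseteq> B"
        by auto
      then show "\<exists>F\<in>?F. F \<subseteq> B"
        using g by auto
    qed (use fin trace in auto)
    also have "\<dots> \<le> card T * M ^ k"
      using card_transversal_traces_le[OF S(1) T finT] by (rule mult_le_mono1)
    finally show ?thesis .
  next
    \<comment> \<open>No \<open>M\<close>-subset of \<open>T\<close> exists to test, but the inequality is then trivial.\<close>
    case False
    then have "card T ^ k \<le> M ^ k"
      by (intro power_mono) auto
    moreover have "M ^ k \<le> card T * M ^ k"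
    proof -
      have "T \<noteq> {}"
        using trace[OF one_closed] pos by auto
      then show ?thesis
        using finT by (simp add: Suc_leI card_gt_0_iff)
    qed
    ultimately show ?thesis
      by (rule le_trans)
  qed
  then show ?thesis
    using M by blast
qed

theorem theorem4:
  fixes G :: "('a, 'b) monoid_scheme" and S :: "'a set"
  assumes "comm_group G" and "finite (carrier G)"
    and "S \<subseteq> carrier G" and "S \<noteq> {}"
  shows "real (translate_number G S) \<ge>
      (real (card (set_stabilizer G S)) - 1) / real (card (set_stabilizer G S)) * real (order G)
      + real_of_int \<lceil>(real (order G) / real (card (set_stabilizer G S)))
          powr (1 - real (card (set_stabilizer G S)) / real (card S))\<rceil>"
proof -
  interpret comm_group G by fact
  let ?H = "set_stabilizer G S"
  let ?h = "card ?H"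
  have sub: "subgroup ?H G"
    using assms(3) by (rule subgroup_set_stabilizer)
  obtain T where T: "right_transversal ?H T"
    using right_transversal_exists[OF sub] by blast
  have T_sub: "T \<subseteq> carrier G"
    using T by (simp add: right_transversal_def)
  let ?n = "card T"
  define k where "k = card (T \<inter> (\<one>\<^bsub>G\<^esub> <#\<^bsub>G\<^esub> S))"
  have k: "card S = ?h * k"
    unfolding k_def by (rule card_transversal_trace[OF assms(3) T one_closed])
  have "card (carrier G) = ?h * card (T \<inter> carrier G)"
    using sub subgroup.subset[OF sub] by (intro card_transversal_Int T) auto
  then have order: "order G = ?h * ?n"
    using T_sub by (simp add: order_def Int_absorb2)
  have "0 < card S"
    using assms finite_subset by (auto simp: card_gt_0_iff)
  then have pos: "0 < ?h" "0 < k"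
    using k by auto
  have npos: "0 < ?n"
    using order order_gt_0_iff_finite assms(2) by (metis mult_0_right not_gr_zero)
  have card_R: "real (card (carrier G - T)) = (real ?h - 1) * real ?n"
  proof -
    have "card (carrier G - T) = ?h * ?n - ?n"
      using T_sub assms(2) order by (simp add: card_Diff_subset finite_subset order_def)
    then show ?thesis
      using pos by (simp add: of_nat_diff left_diff_distrib)
  qed
  have "forces_translate G S (translate_number G S)"
    using translate_number_admissible assms by blast
  then obtain M where M: "translate_number G S = card (carrier G - T) + M"
      and bound: "?n ^ k \<le> ?n * M ^ k"
    using forces_translate_transversal_bound[OF assms(2-4) T k] by blast
  have "real ?n powr (1 - 1 / real k) \<le> real M"
    using pos npos bound by (intro powr_le_of_power_le)
  then have "\<lceil>real ?n powr (1 - 1 / real k)\<rceil> \<le> int M"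
    by (simp add: ceiling_le_iff)
  then have "real_of_int \<lceil>real ?n powr (1 - 1 / real k)\<rceil> \<le> real M"
    by linarith
  then have "(real ?h - 1) * real ?n + real_of_int \<lceil>real ?n powr (1 - 1 / real k)\<rceil>
      \<le> real (translate_number G S)"
    using M card_R by simp
  moreover have "(real ?h - 1) / real ?h * real (order G) = (real ?h - 1) * real ?n"
      "real (order G) / real ?h = real ?n" "real ?h / real (card S) = 1 / real k"
    using order k pos by simp_all
  ultimately show ?thesis
    by simp
qed

end
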